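(* Let $x^L\le x^U$ in $\mathbb{R}^n$, let $g$ be a vector of Lipschitz continuous functions, and let $D=\{x\in\mathbb{R}^n : g(x)\le 0,\ x^L\le x\le x^U\}$. Let $f=(f_1,\ldots,f_k)$ with each $f_j:\mathbb{R}^n\to\mathbb{R}$ bounded and Lipschitz continuous, let $M_i:\mathbb{R}^k\to\mathbb{R}$, $i\in[m]$, be multilinear functions, and let $$\mathcal{G}:=\bigl\{(x,\mu) : x\in D,\ \mu_i=M_i\bigl(f_1(x),\ldots,f_k(x)\bigr)\text{ for } i\in[m]\bigr\}.$$ For $\nu\in\mathbb{N}$ let $\mathcal{H}^\nu$ be the region returned by the axis-aligned outer-approximation procedure described in the context, invoked with the set $S=\operatorname{gr}(f):=\{(x,t) : x\in D,\ t=f(x)\}$ and tolerance $\epsilon=\frac1\nu$. Then, for all $\nu$, $\mathcal{H}^\nu$ is an axis-aligned outer-approximation of $\operatorname{gr}(f)$. Let $$\mathcal{Q}^\nu:=\bigl\{(x,\mu) : (x,t)\in\operatorname{corner}(\mathcal{H}^\nu),\ \mu_i=M_i(t)\text{ for } i\in[m]\bigr\}.$$ Then for every $\nu\in\mathbb{N}$, $\operatorname{conv}(\mathcal{Q}^\nu)$ is a polyhedral relaxation of $\mathcal{G}$ (a polyhedron containing $\mathcal{G}$). Moreover, $\operatorname{conv}(\mathcal{Q}^\nu)\to\operatorname{conv}(\mathcal{G})$ with respect to the Hausdorff distance as $\nu\to\infty$.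
   Context: $[m]=\{1,\ldots,m\}$. A function on $\mathbb{R}^k$ is multilinear if it is affine in each scalar coordinate when the others are fixed. A set in $\mathbb{R}^N$ is axis-aligned (with respect to scalar coordinates) if it is a finite union of boxes (products of closed bounded intervals). A point $v\in\mathbb{R}^N$ is a corner point of such a set $A$ if for each coordinate $j$, $v_j$ is an extreme point of $\operatorname{conv}\{y_j : y\in A,\ y_{j'}=v_{j'}\text{ for all } j'\ne j\}$; $\operatorname{corner}(A)$ is the set of corner points. "$A$ outer-approximates $S$" means $S\subseteq A$. Hausdorff distance: $d_\infty(C,D)=\inf\{\eta\ge 0 : C\subseteq D+\eta B,\ D\subseteq C+\eta B\}$ with $B$ the unit Euclidean ball; $C^\nu\to C$ means $d_\infty(C^\nu,C)\to 0$. The diameter is $\operatorname{diam}(C)=\sup_{y,z\in C}\|y-z\|$. Procedure. Input: a bounded set $S=\{y\in[y^L,y^U] : h_j(y)\le 0,\ j\in[p]\}$ with finite bounds $y^L,y^U\in\mathbb{R}^N$ and Lipschitz $h=(h_1,\ldots,h_p)$, and a tolerance $\epsilon>0$. Start with a stack containing the single box $[y^L,y^U]$ and an empty collection $\mathcal{B}$. While the stack is nonempty, pop a box $B$ and compute $[h^L,h^U]=\texttt{range}(h,B)$. If $h^U_j\le 0$ for all $j$, add $B$ to $\mathcal{B}$; else if $h_j^L>0$ for some $j$, discard $B$; else if $\operatorname{diam}(B)\ge\epsilon$, push onto the stack the $2^N$ sub-boxes obtained by bisecting $B$ in every coordinate; else add $B$ to $\mathcal{B}$. Return the union of the boxes in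 $\mathcal{B}$. Here $\texttt{range}(h,B)$ returns a box $[h^L,h^U]\subset\mathbb{R}^p$ containing $h(B)$, and it is consistent: $\operatorname{diam}(\texttt{range}(h,B))\to 0$ as $\operatorname{diam}(B)\to 0$ (uniformly over boxes $B\subseteq[y^L,y^U]$). An example is $h_j(c)\pm K\max_{y\in B}\|y-c\|$ with $c\in B$ and $K$ a Lipschitz constant. For $S=\operatorname{gr}(f)$, the variables are $y=(x,t)\in\mathbb{R}^{n+k}$, the inequalities are $g(x)\le 0$, $f(x)-t\le 0$, $t-f(x)\le 0$, and the bounds are $x^L\le x\le x^U$ together with finite bounds $t^L\le t\le t^U$ satisfying $t^L\le f(x)\le t^U$ for $x\in[x^L,x^U]$ (available because $f$ is bounded). *)

theory Defs
  imports
    "HOL-Analysis.Analysis"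
    "HOL-Library.While_Combinator"
begin

definition multilinear :: "(real ^ 'k \<Rightarrow> real) \<Rightarrow> bool" where
  "multilinear F \<longleftrightarrow>
     (\<forall>j t. \<exists>a b. \<forall>s. F (\<chi> i. if i = j then s else t $ i) = a + b * s)"

text \<open>
  In a Euclidean space the scalar coordinates of \<open>y\<close> are \<open>y \<bullet> j\<close> for \<open>j \<in> Basis\<close>, and
  the boxes are the sets \<open>cbox a b\<close>. On \<open>(real ^ 'n) \<times> (real ^ 'k)\<close> these are exactly the
  scalar coordinates of the two components.
\<close>

definition axis_aligned :: "'a::euclidean_space set \<Rightarrow> bool" where
  "axis_aligned A \<longleftrightarrow> (\<exists>F. finite F \<and> (\<forall>B\<in>F. \<exists>a b. B = cbox a b) \<and> A = \<Union>F)"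

definition corner :: "'a::euclidean_space set \<Rightarrow> 'a set" where
  "corner A = {v. \<forall>j\<in>Basis.
     (v \<bullet> j) extreme_point_of
       (convex hull {y \<bullet> j |y. y \<in> A \<and> (\<forall>i\<in>Basis - {j}. y \<bullet> i = v \<bullet> i)})}"

text \<open>
  Extended-real valued, so that the distance between the empty set and a nonempty set
  is \<open>\<infinity>\<close>, the infimum of the empty set.
\<close>

definition hausdorff_dist :: "'a::real_normed_vector set \<Rightarrow> 'a set \<Rightarrow> ereal" where
  "hausdorff_dist C D = Inf {ereal \<eta> |\<eta>. 0 \<le> \<eta>
     \<and> C \<subseteq> {y + \<eta> *\<^sub>R u |y u. y \<in> D \<and> u \<in> cball 0 1}
     \<and> D \<subseteq> {y + \<eta> *\<^sub>R u |y u. y \<in> C \<and> u \<in> cball 0 1}}"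

definition feasible :: "('a::euclidean_space \<Rightarrow> 'b::euclidean_space) \<Rightarrow> 'a \<Rightarrow> 'a \<Rightarrow> 'a set" where
  "feasible h yL yU = {y \<in> cbox yL yU. \<forall>j\<in>Basis. h y \<bullet> j \<le> 0}"

text \<open>
  A nonempty box is represented by the pair of its lower and upper corners.
  The union of the child boxes below, over all sets \<open>I\<close> of coordinates, is the bisection of
  \<open>(a, b)\<close> in every coordinate: \<open>I\<close> collects the coordinates in which the upper half is taken.
\<close>

type_synonym 'a box = "'a \<times> 'a"

fun box_set :: "'a::euclidean_space box \<Rightarrow> 'a set" where
  "box_set (a, b) = cbox a b"

fun child_box :: "'a::euclidean_space box \<Rightarrow> 'a set \<Rightarrow> 'a box" where
  "child_box (a, b) I =
     (\<Sum>i\<in>Basis. (if i \<in> I then (a \<bullet> i + b \<bullet> i) / 2 else a \<bullet> i) *\<^sub>R i,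
      \<Sum>i\<in>Basis. (if i \<in> I then b \<bullet> i else (a \<bullet> i + b \<bullet> i) / 2) *\<^sub>R i)"

text \<open>
  The sub-boxes are pushed in an arbitrary order; it does not affect the union of the
  boxes that are eventually kept.
\<close>

definition bisect :: "'a::euclidean_space box \<Rightarrow> 'a box list" where
  "bisect B = map (child_box B) (SOME Is. distinct Is \<and> set Is = Pow Basis)"

text \<open>The oracle \<open>rng\<close> returns the pair \<open>(h\<^sup>L, h\<^sup>U)\<close>.\<close>

definition consistent_range ::
  "(('a::euclidean_space \<Rightarrow> 'b::euclidean_space) \<Rightarrow> 'a box \<Rightarrow> 'b box)
   \<Rightarrow> ('a \<Rightarrow> 'b) \<Rightarrow> 'a \<Rightarrow> 'a \<Rightarrow> bool" where
  "consistent_range rng h yL yU \<longleftrightarrow>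
     (\<forall>B. box_set B \<noteq> {} \<and> box_set B \<subseteq> cbox yL yU \<longrightarrow> h ` box_set B \<subseteq> box_set (rng h B)) \<and>
     (\<forall>e>0. \<exists>d>0. \<forall>B. box_set B \<noteq> {} \<and> box_set B \<subseteq> cbox yL yU \<and> diameter (box_set B) < d
        \<longrightarrow> diameter (box_set (rng h B)) < e)"

text \<open>A state consists of the stack and of the collection of boxes kept so far.\<close>

fun approx_step ::
  "(('a::euclidean_space \<Rightarrow> 'b::euclidean_space) \<Rightarrow> 'a box \<Rightarrow> 'b box)
   \<Rightarrow> ('a \<Rightarrow> 'b) \<Rightarrow> real \<Rightarrow> 'a box list \<times> 'a box set \<Rightarrow> 'a box list \<times> 'a box set" where
  "approx_step rng h \<epsilon> ([], \<B>) = ([], \<B>)"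
| "approx_step rng h \<epsilon> (B # stack, \<B>) =
     (let (hL, hU) = rng h B in
      if \<forall>j\<in>Basis. hU \<bullet> j \<le> 0 then (stack, insert B \<B>)
      else if \<exists>j\<in>Basis. hL \<bullet> j > 0 then (stack, \<B>)
      else if diameter (box_set B) \<ge> \<epsilon> then (bisect B @ stack, \<B>)
      else (stack, insert B \<B>))"

text \<open>
  If the loop did not terminate, \<open>while_option\<close> would be \<open>None\<close> and the result unspecified;
  statements about the returned region therefore include termination.
\<close>

definition outer_approx ::
  "(('a::euclidean_space \<Rightarrow> 'b::euclidean_space) \<Rightarrow> 'a box \<Rightarrow> 'b box)
   \<Rightarrow> ('a \<Rightarrow> 'b) \<Rightarrow> 'a \<Rightarrow> 'a \<Rightarrow> real \<Rightarrow> 'a set" where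
  "outer_approx rng h yL yU \<epsilon> =
     (\<Union>B \<in> snd (the (while_option (\<lambda>(stack, \<B>). stack \<noteq> []) (approx_step rng h \<epsilon>)
                         ([(yL, yU)], {}))).
        box_set B)"

definition graph_on :: "'a set \<Rightarrow> ('a \<Rightarrow> 'b) \<Rightarrow> ('a \<times> 'b) set" where
  "graph_on D f = {(x, t). x \<in> D \<and> t = f x}"

text \<open>The constraints \<open>g x \<le> 0\<close>, \<open>f x - t \<le> 0\<close>, \<open>t - f x \<le> 0\<close> describing the graph of \<open>f\<close>.\<close>

definition graph_constraints ::
  "('a \<Rightarrow> 'c) \<Rightarrow> ('a \<Rightarrow> 'b::ab_group_add) \<Rightarrow> 'a \<times> 'b \<Rightarrow> 'c \<times> 'b \<times> 'b" where
  "graph_constraints g f = (\<lambda>(x, t). (g x, f x - t, t - f x))"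

lemma feasible_graph_constraints:
  fixes g :: "'a::euclidean_space \<Rightarrow> 'c::euclidean_space"
    and f :: "'a \<Rightarrow> 'b::euclidean_space"
  assumes "\<And>x. x \<in> cbox xL xU \<Longrightarrow> f x \<in> cbox tL tU"
  shows "feasible (graph_constraints g f) (xL, tL) (xU, tU) = graph_on (feasible g xL xU) f"
proof -
  have "(\<forall>j\<in>Basis. graph_constraints g f (x, t) \<bullet> j \<le> 0)
      \<longleftrightarrow> (\<forall>j\<in>Basis. g x \<bullet> j \<le> 0) \<and> t = f x" for x t
  proof -
    have "(\<forall>j\<in>Basis. graph_constraints g f (x, t) \<bullet> j \<le> 0)
        \<longleftrightarrow> (\<forall>j\<in>Basis. g x \<bullet> j \<le> 0) \<and> (\<forall>j\<in>Basis. f x \<bullet> j \<le> t \<bullet> j \<and> t \<bullet> j \<le> f x \<bullet> j)"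
      by (simp add: graph_constraints_def Basis_prod_def ball_Un inner_diff_left ball_conj_distrib)
    also have "(\<forall>j\<in>Basis. f x \<bullet> j \<le> t \<bullet> j \<and> t \<bullet> j \<le> f x \<bullet> j) \<longleftrightarrow> t = f x"
      using euclidean_eq_iff[of t "f x"] by (metis order_antisym order_refl)
    finally show ?thesis .
  qed
  then show ?thesis
    using assms unfolding feasible_def graph_on_def cbox_Pair_eq by auto
qed

end

theory Submission
  imports Defs
begin

text \<open>
  Write \<open>\<Phi>(x, t) = (x, M\<^sub>1(t), \<dots>, M\<^sub>m(t))\<close>, \<open>S\<close> for the graph of \<open>f\<close> over \<open>D\<close> and \<open>H\<close> for a
  region returned by the procedure, so that \<open>G = \<Phi>(S)\<close> and \<open>Q = \<Phi>(corner H)\<close>.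

  The procedure terminates because bisection halves diameters and boxes smaller than the
  tolerance are never bisected. It never loses a point of \<open>S\<close>, so \<open>S \<subseteq> H\<close>
  (\<open>outer_approx_correct\<close>).

  The polyhedral relaxation needs two facts about corners. A finite union of boxes has finitely
  many corners, since each of them is a vertex of one of the boxes (\<open>finite_corner\<close>). And a
  function \<open>F\<close> that is affine in each coordinate attains its maximum over a nonempty compact set
  \<open>A\<close> at a corner of \<open>A\<close> (\<open>corner_maximum\<close>): among the maximisers take one of largest norm; if it
  lay strictly between two points of \<open>A\<close> on a line parallel to an axis, then \<open>F\<close> would be constant
  on that line, and one of the two points would be a maximiser of larger norm. Since every
  linear functional of \<open>\<Phi>\<close> is affine in each coordinate, no point of \<open>\<Phi>(H)\<close> can be strictly
  separated from \<open>conv (\<Phi>(corner H))\<close>, so \<open>G \<subseteq> \<Phi>(H) \<subseteq> conv Q\<close> (\<open>image_in_hull_corners\<close>).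

  For the convergence, a kept box either lies in \<open>S\<close> or has an enclosure of small diameter whose
  lower bounds are nonpositive; hence the constraints are violated by at most \<open>\<delta>\<close> on \<open>H\<close>, with
  \<open>\<delta> \<rightarrow> 0\<close> as the tolerance tends to 0. By compactness and continuity of \<open>\<Phi>\<close>, every point of
  \<open>\<Phi>(H)\<close> is then within any given \<open>\<eta> > 0\<close> of \<open>\<Phi>(S) = G\<close> (\<open>outer_approx_near\<close>). As
  \<open>corner H \<subseteq> H\<close>, the set \<open>conv Q\<close> lies in the \<open>\<eta>\<close>-neighbourhood of \<open>conv G\<close>. The same argument
  shows that \<open>H\<close> is eventually empty when \<open>S\<close> is empty.
\<close>

section \<open>Functions affine in each coordinate\<close>

text \<open>
  Multilinearity on an arbitrary Euclidean space: the function is affine along every line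
  parallel to a coordinate axis. The slope \<open>c\<close> may depend on the line.
\<close>

definition coord_affine :: "('a::euclidean_space \<Rightarrow> real) \<Rightarrow> bool" where
  "coord_affine F \<longleftrightarrow> (\<forall>v. \<forall>j\<in>Basis. \<exists>c. \<forall>s. F (v + s *\<^sub>R j) = F v + c * s)"

lemma coord_affineE:
  assumes "coord_affine F" "j \<in> Basis"
  obtains c where "\<And>s. F (v + s *\<^sub>R j) = F v + c * s"
  using assms unfolding coord_affine_def by metis

lemma multilinear_coord_affine:
  fixes F :: "real ^ 'k \<Rightarrow> real"
  assumes "multilinear F"
  shows "coord_affine F"
  unfolding coord_affine_def
proof (intro allI ballI)
  fix v j :: "real ^ 'k"
  assume "j \<in> Basis"
  then obtain l where l: "j = axis l 1"
    by (auto simp: Basis_vec_def)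
  obtain a b where ab: "F (\<chi> i. if i = l then s else v $ i) = a + b * s" for s
    using assms unfolding multilinear_def by metis
  have upd: "v + s *\<^sub>R j = (\<chi> i. if i = l then v $ l + s else v $ i)" for s
    by (auto simp: vec_eq_iff l axis_def)
  have F: "F (v + s *\<^sub>R j) = a + b * (v $ l + s)" for s
    unfolding upd ab ..
  have "F (v + s *\<^sub>R j) = F v + b * s" for s
    using F[of s] F[of 0] by (simp add: algebra_simps)
  then show "\<exists>c. \<forall>s. F (v + s *\<^sub>R j) = F v + c * s"
    by blast
qed

lemma coord_affine_add:
  assumes "coord_affine F" "coord_affine F'"
  shows "coord_affine (\<lambda>y. F y + F' y)"
  unfolding coord_affine_def
proof (intro allI ballI)
  fix v j :: 'a
  assume j: "j \<in> Basis"
  obtain c c' where "\<And>s. F (v + s *\<^sub>R j) = F v + c * s" "\<And>s. F' (v + s *\<^sub>R j) = F' v + c' * s"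
    using coord_affineE[OF assms(1) j] coord_affineE[OF assms(2) j] by metis
  then have "\<forall>s. F (v + s *\<^sub>R j) + F' (v + s *\<^sub>R j) = F v + F' v + (c + c') * s"
    by (simp add: algebra_simps)
  then show "\<exists>d. \<forall>s. F (v + s *\<^sub>R j) + F' (v + s *\<^sub>R j) = F v + F' v + d * s"
    by blast
qed

lemma coord_affine_cmult:
  assumes "coord_affine F"
  shows "coord_affine (\<lambda>y. d * F y)"
  unfolding coord_affine_def
proof (intro allI ballI)
  fix v j :: 'a
  assume j: "j \<in> Basis"
  obtain c where "\<And>s. F (v + s *\<^sub>R j) = F v + c * s"
    using coord_affineE[OF assms j] by metis
  then have "\<forall>s. d * F (v + s *\<^sub>R j) = d * F v + (d * c) * s"
    by (simp add: algebra_simps)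
  then show "\<exists>c. \<forall>s. d * F (v + s *\<^sub>R j) = d * F v + c * s"
    by blast
qed

lemma coord_affine_sum:
  assumes "\<And>i. i \<in> I \<Longrightarrow> coord_affine (F i)"
  shows "coord_affine (\<lambda>y. \<Sum>i\<in>I. F i y)"
  using assms
proof (induction I rule: infinite_finite_induct)
  case (insert i I)
  then show ?case
    by (simp add: coord_affine_add)
qed (auto simp: coord_affine_def)

lemma coord_affine_linear:
  assumes "linear F"
  shows "coord_affine F"
  unfolding coord_affine_def
proof (intro allI ballI)
  fix v j :: 'a
  have "\<forall>s. F (v + s *\<^sub>R j) = F v + F j * s"
    by (simp add: linear_add[OF assms] linear_scale[OF assms])
  then show "\<exists>c. \<forall>s. F (v + s *\<^sub>R j) = F v + c * s" ..
qed

lemma coord_affine_snd: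
  assumes "coord_affine F"
  shows "coord_affine (\<lambda>y :: 'a::euclidean_space \<times> 'b::euclidean_space. F (snd y))"
  unfolding coord_affine_def
proof (intro allI ballI)
  fix v j :: "'a \<times> 'b"
  assume "j \<in> Basis"
  then consider "snd j = 0" | "snd j \<in> Basis"
    by (auto simp: Basis_prod_def)
  then show "\<exists>c. \<forall>s. F (snd (v + s *\<^sub>R j)) = F (snd v) + c * s"
  proof cases
    case 1
    then show ?thesis by (intro exI[of _ 0]) simp
  next
    case 2
    show ?thesis
      by (rule coord_affineE[OF assms 2, of "snd v"]) auto
  qed
qed

text \<open>
  By induction on the set \<open>I\<close> of coordinates that are allowed to vary: along a further coordinate
  \<open>j\<close> the function is interpolated from its values at \<open>0\<close> and \<open>j\<close>.
\<close>

lemma continuous_on_coord_affine: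
  fixes F :: "'a::euclidean_space \<Rightarrow> real"
  assumes "coord_affine F"
  shows "continuous_on X F"
proof -
  have "continuous_on UNIV (\<lambda>t. F (w + (\<Sum>i\<in>I. (t \<bullet> i) *\<^sub>R i)))" if "finite I" "I \<subseteq> Basis" for I w
    using that
  proof (induction I arbitrary: w rule: finite_induct)
    case empty
    then show ?case by simp
  next
    case (insert j I)
    let ?s = "\<lambda>t. \<Sum>i\<in>I. (t \<bullet> i) *\<^sub>R i"
    have "F (w + (\<Sum>i\<in>insert j I. (t \<bullet> i) *\<^sub>R i))
        = F (w + ?s t) + (t \<bullet> j) * (F ((w + j) + ?s t) - F (w + ?s t))" for t
    proof -
      obtain c where c: "\<And>s. F ((w + ?s t) + s *\<^sub>R j) = F (w + ?s t) + c * s"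
        using coord_affineE[OF assms] insert.prems by (metis insert_subset)
      show ?thesis
        using c[of "t \<bullet> j"] c[of 1] insert.hyps by (simp add: algebra_simps)
    qed
    moreover have "continuous_on UNIV
        (\<lambda>t. F (w + ?s t) + (t \<bullet> j) * (F ((w + j) + ?s t) - F (w + ?s t)))"
      using insert.IH[of w] insert.IH[of "w + j"] insert.prems
      by (intro continuous_intros) auto
    ultimately show ?case
      by simp
  qed
  from this[of Basis 0] have "continuous_on UNIV F"
    by (simp add: euclidean_representation)
  then show ?thesis
    using continuous_on_subset by blast
qed

section \<open>Corner points\<close>

lemma extreme_point_of_hull_real_iff:
  fixes T :: "real set"
  shows "x extreme_point_of (convex hull T)
    \<longleftrightarrow> x \<in> T \<and> \<not> (\<exists>a\<in>T. \<exists>b\<in>T. a < x \<and> x < b)" (is "?l \<longleftrightarrow> ?r")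
proof
  assume l: ?l
  have "x \<in> T"
    using l extreme_point_of_convex_hull by blast
  moreover have False if "a \<in> T" "b \<in> T" "a < x" "x < b" for a b
  proof -
    have "x \<in> open_segment a b"
      using that by (simp add: open_segment_eq_real_ivl)
    then show False
      using l that hull_inc[of a T convex] hull_inc[of b T convex]
      unfolding extreme_point_of_def by blast
  qed
  ultimately show ?r by blast
next
  assume r: ?r
  have "T \<subseteq> {..x} \<or> T \<subseteq> {x..}"
    using r by (auto simp: subset_eq)
  then have one_side: "convex hull T \<subseteq> {..x} \<or> convex hull T \<subseteq> {x..}"
    using hull_minimal[of T _ convex] by (meson convex_real_interval)
  have "x \<notin> open_segment a b" if "a \<in> convex hull T" "b \<in> convex hull T" for a b
  proof -
    have "a \<le> x \<and> b \<le> x \<or> x \<le> a \<and> x \<le> b"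
      using one_side that by blast
    then show ?thesis
      by (auto simp: open_segment_eq_real_ivl)
  qed
  moreover have "x \<in> convex hull T"
    using r by (simp add: hull_inc)
  ultimately show ?l
    unfolding extreme_point_of_def by blast
qed

text \<open>
  The working description of corners: a point of \<open>A\<close> is a corner unless, on some line parallel to
  an axis, it lies strictly between two other points of \<open>A\<close>.
\<close>

lemma corner_iff:
  fixes A :: "'a::euclidean_space set"
  shows "v \<in> corner A \<longleftrightarrow>
    v \<in> A \<and> (\<forall>j\<in>Basis. \<not> (\<exists>p>0. \<exists>q>0. v - p *\<^sub>R j \<in> A \<and> v + q *\<^sub>R j \<in> A))"
proof -
  have line: "{y \<bullet> j |y. y \<in> A \<and> (\<forall>i\<in>Basis - {j}. y \<bullet> i = v \<bullet> i)}
      = {v \<bullet> j + s |s. v + s *\<^sub>R j \<in> A}" (is "?L = ?R") if j: "j \<in> Basis" for j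
  proof (intro equalityI subsetI)
    fix r assume "r \<in> ?L"
    then obtain y where y: "r = y \<bullet> j" "y \<in> A" "\<forall>i\<in>Basis - {j}. y \<bullet> i = v \<bullet> i"
      by blast
    have "y = v + (y \<bullet> j - v \<bullet> j) *\<^sub>R j"
      using y(3) j by (auto simp: euclidean_eq_iff[of y] inner_left_distrib inner_Basis)
    then show "r \<in> ?R"
      using y by (auto intro!: exI[of _ "y \<bullet> j - v \<bullet> j"])
  next
    fix r assume "r \<in> ?R"
    then obtain s where s: "r = v \<bullet> j + s" "v + s *\<^sub>R j \<in> A"
      by blast
    then show "r \<in> ?L"
      using j by (auto intro!: exI[of _ "v + s *\<^sub>R j"] simp: inner_left_distrib inner_Basis
          split: if_splits)
  qed
  have "(v \<bullet> j) extreme_point_of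
       (convex hull {y \<bullet> j |y. y \<in> A \<and> (\<forall>i\<in>Basis - {j}. y \<bullet> i = v \<bullet> i)})
     \<longleftrightarrow> v \<in> A \<and> \<not> (\<exists>p>0. \<exists>q>0. v - p *\<^sub>R j \<in> A \<and> v + q *\<^sub>R j \<in> A)" (is "?l \<longleftrightarrow> ?r")
    if j: "j \<in> Basis" for j
  proof -
    have "?l \<longleftrightarrow> v \<in> A \<and> \<not> (\<exists>s t. v + s *\<^sub>R j \<in> A \<and> v + t *\<^sub>R j \<in> A \<and> s < 0 \<and> 0 < t)"
      unfolding line[OF j] extreme_point_of_hull_real_iff by auto
    also have "(\<exists>s t. v + s *\<^sub>R j \<in> A \<and> v + t *\<^sub>R j \<in> A \<and> s < 0 \<and> 0 < t)
        \<longleftrightarrow> (\<exists>p>0. \<exists>q>0. v - p *\<^sub>R j \<in> A \<and> v + q *\<^sub>R j \<in> A)"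
    proof
      assume "\<exists>s t. v + s *\<^sub>R j \<in> A \<and> v + t *\<^sub>R j \<in> A \<and> s < 0 \<and> 0 < t"
      then obtain s t where "v + s *\<^sub>R j \<in> A" "v + t *\<^sub>R j \<in> A" "s < 0" "0 < t"
        by blast
      then show "\<exists>p>0. \<exists>q>0. v - p *\<^sub>R j \<in> A \<and> v + q *\<^sub>R j \<in> A"
        by (intro exI[of _ "- s"] conjI exI[of _ t]) auto
    next
      assume "\<exists>p>0. \<exists>q>0. v - p *\<^sub>R j \<in> A \<and> v + q *\<^sub>R j \<in> A"
      then obtain p q where "v - p *\<^sub>R j \<in> A" "v + q *\<^sub>R j \<in> A" "p > 0" "q > 0"
        by blast
      then show "\<exists>s t. v + s *\<^sub>R j \<in> A \<and> v + t *\<^sub>R j \<in> A \<and> s < 0 \<and> 0 < t"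
        by (intro exI[of _ "- p"] exI[of _ q]) auto
    qed
    finally show ?thesis .
  qed
  then have "v \<in> corner A \<longleftrightarrow> (\<forall>j\<in>Basis.
      v \<in> A \<and> \<not> (\<exists>p>0. \<exists>q>0. v - p *\<^sub>R j \<in> A \<and> v + q *\<^sub>R j \<in> A))"
    unfolding corner_def by blast
  then show ?thesis
    using nonempty_Basis by blast
qed

lemma corner_subset: "corner A \<subseteq> A"
  by (auto simp: corner_iff)

lemma finite_corner:
  fixes A :: "'a::euclidean_space set"
  assumes "axis_aligned A"
  shows "finite (corner A)"
proof -
  obtain F where F: "finite F" "\<forall>B\<in>F. \<exists>a b. B = cbox a b" "A = \<Union>F"
    using assms unfolding axis_aligned_def by blast
  obtain l u where lu: "\<And>B. B \<in> F \<Longrightarrow> B = cbox (l B) (u B)"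
    using F(2) by metis
  define vertex where
    "vertex B I = (\<Sum>i\<in>Basis. (if i \<in> I then l B \<bullet> i else u B \<bullet> i) *\<^sub>R i)" for B I
  have "corner A \<subseteq> (\<Union>B\<in>F. vertex B ` Pow Basis)"
  proof
    fix v assume v: "v \<in> corner A"
    then obtain B where B: "B \<in> F" "v \<in> B"
      using F(3) corner_subset by blast
    then have in_box: "v \<in> cbox (l B) (u B)"
      using lu by blast
    have "v \<bullet> j = l B \<bullet> j \<or> v \<bullet> j = u B \<bullet> j" if j: "j \<in> Basis" for j
    proof (rule ccontr)
      assume "\<not> ?thesis"
      then have less: "l B \<bullet> j < v \<bullet> j" "v \<bullet> j < u B \<bullet> j"
        using in_box j by (auto simp: mem_box order.order_iff_strict)
      \<comment> \<open>move to the two faces of the box along the direction \<open>j\<close>\<close>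
      have "v - (v \<bullet> j - l B \<bullet> j) *\<^sub>R j \<in> cbox (l B) (u B)"
        "v + (u B \<bullet> j - v \<bullet> j) *\<^sub>R j \<in> cbox (l B) (u B)"
        using in_box less j by (auto simp: mem_box inner_diff_left inner_left_distrib inner_Basis)
      then have "v - (v \<bullet> j - l B \<bullet> j) *\<^sub>R j \<in> A" "v + (u B \<bullet> j - v \<bullet> j) *\<^sub>R j \<in> A"
        using lu B F(3) by blast+
      then show False
        using v j less unfolding corner_iff by (metis diff_gt_0_iff_gt)
    qed
    then have "v = vertex B {j\<in>Basis. v \<bullet> j = l B \<bullet> j}"
      by (auto simp: vertex_def euclidean_eq_iff[of v] cong: if_cong)
    then show "v \<in> (\<Union>B\<in>F. vertex B ` Pow Basis)"
      using B by blast
  qed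
  then show ?thesis
    by (rule finite_subset) (use F in auto)
qed

lemma corner_maximum:
  fixes F :: "'a::euclidean_space \<Rightarrow> real"
  assumes "compact A" "coord_affine F" "y \<in> A"
  shows "\<exists>v\<in>corner A. F y \<le> F v"
proof -
  have cont: "continuous_on UNIV F"
    by (rule continuous_on_coord_affine[OF assms(2)])
  obtain w where w: "w \<in> A" "\<And>z. z \<in> A \<Longrightarrow> F z \<le> F w"
    using continuous_attains_sup[of A F] assms(1,3) continuous_on_subset[OF cont] by blast
  define A' where "A' = A \<inter> {z. F z = F w}"
  have "compact A'"
    unfolding A'_def
    by (intro compact_Int_closed assms closed_Collect_eq cont continuous_intros)
  then obtain v where v: "v \<in> A'" "\<And>z. z \<in> A' \<Longrightarrow> norm z \<le> norm v"
    using continuous_attains_sup[of A' norm] w by (auto simp: A'_def intro: continuous_intros)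
  have "False" if j: "j \<in> Basis" and pq: "p > 0" "q > 0" "v - p *\<^sub>R j \<in> A" "v + q *\<^sub>R j \<in> A" for j p q
  proof -
    obtain c where c: "\<And>s. F (v + s *\<^sub>R j) = F v + c * s"
      using coord_affineE[OF assms(2) j] by metis
    have Fv: "F v = F w" and "v \<in> A"
      using v by (auto simp: A'_def)
    have eqs: "F (v - p *\<^sub>R j) = F v - c * p" "F (v + q *\<^sub>R j) = F v + c * q"
      using c[of "- p"] c[of q] by auto
    have "c * p \<ge> 0" "c * q \<le> 0"
      using w(2)[OF pq(3)] w(2)[OF pq(4)] Fv eqs by auto
    then have "c = 0"
      using pq by (simp add: zero_le_mult_iff mult_le_0_iff)
    then have "norm (v - p *\<^sub>R j) \<le> norm v" "norm (v + q *\<^sub>R j) \<le> norm v"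
      using eqs Fv pq by (auto intro!: v(2) simp: A'_def)
    then have "(v - p *\<^sub>R j) \<bullet> (v - p *\<^sub>R j) \<le> v \<bullet> v" "(v + q *\<^sub>R j) \<bullet> (v + q *\<^sub>R j) \<le> v \<bullet> v"
      by (simp_all add: norm_le)
    then have "p * (p - 2 * (v \<bullet> j)) \<le> 0" "q * (q + 2 * (v \<bullet> j)) \<le> 0"
      using j by (simp_all add: algebra_simps inner_commute)
    then show False
      using pq by (simp add: mult_le_0_iff)
  qed
  then have "v \<in> corner A"
    using v(1) unfolding corner_iff A'_def by blast
  then show ?thesis
    using v(1) w(2)[OF assms(3)] by (intro bexI[of _ v]) (auto simp: A'_def)
qed

lemma image_in_hull_corners:
  fixes \<Phi> :: "'a::euclidean_space \<Rightarrow> 'b::euclidean_space"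
  assumes "compact A" "finite (corner A)" "\<And>u. coord_affine (\<lambda>y. u \<bullet> \<Phi> y)" "y \<in> A"
  shows "\<Phi> y \<in> convex hull (\<Phi> ` corner A)"
proof (rule ccontr)
  assume "\<Phi> y \<notin> convex hull (\<Phi> ` corner A)"
  moreover have "closed (convex hull (\<Phi> ` corner A))"
    using assms(2) by (simp add: compact_imp_closed finite_imp_compact_convex_hull)
  ultimately obtain u b where
    u: "u \<bullet> \<Phi> y < b" "\<forall>z\<in>convex hull (\<Phi> ` corner A). b < u \<bullet> z"
    using separating_hyperplane_closed_point[OF convex_convex_hull] by metis
  obtain v where "v \<in> corner A" "(- u) \<bullet> \<Phi> y \<le> (- u) \<bullet> \<Phi> v"
    using corner_maximum[OF assms(1) assms(3)[of "- u"] assms(4)] by blast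
  then show False
    using u hull_inc[of "\<Phi> v" "\<Phi> ` corner A" convex] by force
qed

section \<open>The bisection procedure\<close>

lemma set_bisect: "set (bisect B) = child_box B ` Pow Basis"
  and length_bisect: "length (bisect (B :: 'a::euclidean_space box)) = 2 ^ DIM('a)"
proof -
  let ?P = "\<lambda>Is. distinct Is \<and> set Is = Pow (Basis :: 'a set)"
  have "?P (SOME Is. ?P Is)"
    by (rule someI_ex) (use finite_distinct_list[of "Pow (Basis :: 'a set)"] in auto)
  then show "set (bisect B) = child_box B ` Pow Basis"
    and "length (bisect B) = 2 ^ DIM('a)"
    unfolding bisect_def by (auto simp: card_Pow dest: distinct_card)
qed

lemma child_box_subset:
  assumes "box_set B \<noteq> {}"
  shows "box_set (child_box B I) \<noteq> {} \<and> box_set (child_box B I) \<subseteq> box_set B"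
proof (cases B)
  case (Pair a b)
  then have "\<forall>i\<in>Basis. a \<bullet> i \<le> b \<bullet> i"
    using assms by (simp add: box_ne_empty)
  then have "\<forall>i\<in>Basis. a \<bullet> i \<le> (a \<bullet> i + b \<bullet> i) / 2 \<and> (a \<bullet> i + b \<bullet> i) / 2 \<le> b \<bullet> i"
    by auto
  then show ?thesis
    by (simp add: Pair box_ne_empty subset_box)
qed

lemma bisect_covers:
  assumes "y \<in> box_set B"
  shows "\<exists>C\<in>set (bisect B). y \<in> box_set C"
proof (cases B)
  case (Pair a b)
  let ?I = "{i\<in>Basis. (a \<bullet> i + b \<bullet> i) / 2 \<le> y \<bullet> i}"
  have "y \<in> box_set (child_box B ?I)"
    using assms by (auto simp: Pair mem_box)
  then show ?thesis
    unfolding set_bisect by blast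
qed

lemma diameter_child_box:
  assumes "box_set B \<noteq> {}"
  shows "diameter (box_set (child_box B I)) = diameter (box_set B) / 2"
proof (cases B)
  case (Pair a b)
  obtain a' b' where ab': "child_box B I = (a', b')"
    by fastforce
  have le: "\<forall>i\<in>Basis. a \<bullet> i \<le> b \<bullet> i" "\<forall>i\<in>Basis. a' \<bullet> i \<le> b' \<bullet> i"
    using assms child_box_subset[OF assms, of I] ab' by (auto simp: Pair box_ne_empty)
  have "b' - a' = (1/2) *\<^sub>R (b - a)"
    by (rule euclidean_eqI) (use ab' in \<open>auto simp: Pair inner_diff_left field_simps\<close>)
  then have "dist a' b' = dist a b / 2"
    by (simp add: dist_norm norm_minus_commute[of a] norm_minus_commute[of a'])
  then show ?thesis
    using le unfolding ab' by (simp add: Pair diameter_cbox)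
qed

text \<open>
  The number of bisections after which a box of diameter \<open>d\<close> is smaller than the tolerance.
\<close>

definition depth :: "real \<Rightarrow> real \<Rightarrow> nat" where
  "depth \<epsilon> d = (LEAST k. d < 2 ^ k * \<epsilon>)"

lemma depth_halve:
  assumes "\<epsilon> > 0" "d \<ge> \<epsilon>"
  shows "depth \<epsilon> d = Suc (depth \<epsilon> (d / 2))"
proof -
  obtain n where "d / \<epsilon> < 2 ^ n"
    using real_arch_pow[of 2 "d / \<epsilon>"] by auto
  then have "d < 2 ^ n * \<epsilon>"
    using assms by (simp add: field_simps)
  then have "depth \<epsilon> d = Suc (LEAST m. d < 2 ^ Suc m * \<epsilon>)"
    unfolding depth_def using assms by (intro Least_Suc) auto
  also have "(LEAST m. d < 2 ^ Suc m * \<epsilon>) = depth \<epsilon> (d / 2)"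
    unfolding depth_def by (rule arg_cong[of _ _ Least]) (auto simp: field_simps)
  finally show ?thesis .
qed

text \<open>
  The termination measure. The base exceeds the number of children of a box, so that a box
  outweighs all its children together.
\<close>

definition stack_weight :: "real \<Rightarrow> 'a::euclidean_space box list \<Rightarrow> nat" where
  "stack_weight \<epsilon> stack =
     (\<Sum>B\<leftarrow>stack. Suc (2 ^ DIM('a)) ^ depth \<epsilon> (diameter (box_set B)))"

lemma stack_weight_bisect:
  fixes B :: "'a::euclidean_space box"
  assumes "\<epsilon> > 0" "diameter (box_set B) \<ge> \<epsilon>"
  shows "stack_weight \<epsilon> (bisect B) < stack_weight \<epsilon> [B]"
proof -
  let ?N = "2 ^ DIM('a) :: nat" and ?d = "depth \<epsilon> (diameter (box_set B) / 2)"
  have "box_set B \<noteq> {}"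
    using assms by auto
  then have map_eq: "map (\<lambda>C. Suc ?N ^ depth \<epsilon> (diameter (box_set C))) (bisect B)
      = map (\<lambda>_. Suc ?N ^ ?d) (bisect B)"
    by (auto simp: set_bisect diameter_child_box)
  have "stack_weight \<epsilon> (bisect B) = ?N * Suc ?N ^ ?d"
    unfolding stack_weight_def map_eq by (simp only: sum_list_triv length_bisect of_nat_id)
  also have "\<dots> < Suc ?N ^ Suc ?d"
    by simp
  also have "\<dots> = stack_weight \<epsilon> [B]"
    by (simp add: stack_weight_def depth_halve[OF assms])
  finally show ?thesis .
qed

lemma stack_weight_step:
  assumes "\<epsilon> > 0" "stack \<noteq> []"
  shows "stack_weight \<epsilon> (fst (approx_step rng h \<epsilon> (stack, \<B>))) < stack_weight \<epsilon> stack"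
proof -
  obtain B rest where stack: "stack = B # rest"
    using assms(2) by (cases stack) auto
  have pos: "stack_weight \<epsilon> rest < stack_weight \<epsilon> (B # rest)"
    by (simp add: stack_weight_def)
  have "stack_weight \<epsilon> (bisect B @ rest) < stack_weight \<epsilon> (B # rest)"
    if "diameter (box_set B) \<ge> \<epsilon>"
    using stack_weight_bisect[OF assms(1) that] by (simp add: stack_weight_def)
  then show ?thesis
    using pos by (auto simp: stack Let_def split: prod.splits)
qed

text \<open>
  The loop invariant. The last clause records why a box was kept: its enclosure proves it
  feasible, or it is small and its enclosure does not prove it infeasible.
\<close>

definition approx_inv ::
  "(('a::euclidean_space \<Rightarrow> 'b::euclidean_space) \<Rightarrow> 'a box \<Rightarrow> 'b box)
   \<Rightarrow> ('a \<Rightarrow> 'b) \<Rightarrow> 'a \<Rightarrow> 'a \<Rightarrow> real \<Rightarrow> 'a box list \<times> 'a box set \<Rightarrow> bool" where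
  "approx_inv rng h yL yU \<epsilon> = (\<lambda>(stack, \<B>).
     finite \<B> \<and>
     (\<forall>B \<in> set stack \<union> \<B>. box_set B \<noteq> {} \<and> box_set B \<subseteq> cbox yL yU) \<and>
     feasible h yL yU \<subseteq> (\<Union>B \<in> set stack \<union> \<B>. box_set B) \<and>
     (\<forall>B\<in>\<B>. (\<forall>j\<in>Basis. snd (rng h B) \<bullet> j \<le> 0)
        \<or> diameter (box_set B) < \<epsilon> \<and> (\<forall>j\<in>Basis. fst (rng h B) \<bullet> j \<le> 0)))"

lemma range_bounds:
  assumes "consistent_range rng h yL yU" "box_set B \<subseteq> cbox yL yU" "y \<in> box_set B" "j \<in> Basis"
  shows "fst (rng h B) \<bullet> j \<le> h y \<bullet> j" "h y \<bullet> j \<le> snd (rng h B) \<bullet> j"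
proof -
  have "h y \<in> box_set (rng h B)"
    using assms unfolding consistent_range_def by blast
  then show "fst (rng h B) \<bullet> j \<le> h y \<bullet> j" "h y \<bullet> j \<le> snd (rng h B) \<bullet> j"
    using assms(4) by (cases "rng h B"; auto simp: mem_box)+
qed

lemma approx_inv_step:
  assumes cons: "consistent_range rng h yL yU"
    and inv: "approx_inv rng h yL yU \<epsilon> (stack, \<B>)" and "stack \<noteq> []"
  shows "approx_inv rng h yL yU \<epsilon> (approx_step rng h \<epsilon> (stack, \<B>))"
proof -
  obtain B rest where stack: "stack = B # rest"
    using assms(3) by (cases stack) auto
  obtain hL hU where r: "rng h B = (hL, hU)"
    by fastforce
  have B: "box_set B \<noteq> {}" "box_set B \<subseteq> cbox yL yU"
    using inv by (auto simp: approx_inv_def stack)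
  have cover: "feasible h yL yU \<subseteq> box_set B \<union> (\<Union>B \<in> set rest \<union> \<B>. box_set B)"
    using inv by (auto simp: approx_inv_def stack)
  consider (feasible) "\<forall>j\<in>Basis. hU \<bullet> j \<le> 0"
    | (infeasible) j where "\<not> (\<forall>j\<in>Basis. hU \<bullet> j \<le> 0)" "j \<in> Basis" "hL \<bullet> j > 0"
    | (split) "\<not> (\<forall>j\<in>Basis. hU \<bullet> j \<le> 0)" "\<not> (\<exists>j\<in>Basis. hL \<bullet> j > 0)"
        "diameter (box_set B) \<ge> \<epsilon>"
    | (small) "\<not> (\<forall>j\<in>Basis. hU \<bullet> j \<le> 0)" "\<not> (\<exists>j\<in>Basis. hL \<bullet> j > 0)"
        "\<not> diameter (box_set B) \<ge> \<epsilon>"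
    by blast
  then show ?thesis
  proof cases
    case feasible
    then have "approx_step rng h \<epsilon> (stack, \<B>) = (rest, insert B \<B>)"
      by (simp add: stack r)
    then show ?thesis
      using inv feasible by (auto simp: approx_inv_def stack r)
  next
    case infeasible
    then have step: "approx_step rng h \<epsilon> (stack, \<B>) = (rest, \<B>)"
      by (auto simp: stack r)
    have "y \<notin> feasible h yL yU" if "y \<in> box_set B" for y
      using range_bounds(1)[OF cons B(2) that infeasible(2)] infeasible(2,3) r
      by (force simp: feasible_def)
    then have "feasible h yL yU \<subseteq> (\<Union>B \<in> set rest \<union> \<B>. box_set B)"
      using cover by blast
    then show ?thesis
      using inv unfolding step by (auto simp: approx_inv_def stack)
  next
    case split
    then have step: "approx_step rng h \<epsilon> (stack, \<B>) = (bisect B @ rest, \<B>)"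
      by (auto simp: stack r)
    have "box_set C \<noteq> {} \<and> box_set C \<subseteq> cbox yL yU" if "C \<in> set (bisect B)" for C
      using that child_box_subset[OF B(1)] B(2) by (fastforce simp: set_bisect)
    moreover have "box_set B \<subseteq> (\<Union>C \<in> set (bisect B). box_set C)"
      using bisect_covers by blast
    then have "feasible h yL yU \<subseteq> (\<Union>C \<in> set (bisect B @ rest) \<union> \<B>. box_set C)"
      using cover by fastforce
    ultimately show ?thesis
      using inv unfolding step by (auto simp: approx_inv_def stack)
  next
    case small
    then have "approx_step rng h \<epsilon> (stack, \<B>) = (rest, insert B \<B>)"
      by (auto simp: stack r)
    then show ?thesis
      using inv small by (auto simp: approx_inv_def stack r not_less not_le)
  qed
qed

lemma outer_approx_correct:
  assumes cons: "consistent_range rng h yL yU" and ne: "cbox yL yU \<noteq> {}" and "\<epsilon> > 0"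
  obtains \<B> where "outer_approx rng h yL yU \<epsilon> = (\<Union>B\<in>\<B>. box_set B)"
    "approx_inv rng h yL yU \<epsilon> ([], \<B>)"
proof -
  let ?c = "\<lambda>(stack :: 'a box list, \<B> :: 'a box set). stack \<noteq> []"
  let ?w = "while_option ?c (approx_step rng h \<epsilon>) ([(yL, yU)], {})"
  have init: "approx_inv rng h yL yU \<epsilon> ([(yL, yU)], {})"
    using ne by (auto simp: approx_inv_def feasible_def)
  have inv: "approx_inv rng h yL yU \<epsilon> (approx_step rng h \<epsilon> s)"
    if "approx_inv rng h yL yU \<epsilon> s" "?c s" for s
    using approx_inv_step[OF cons] that by (cases s) auto
  have decr: "stack_weight \<epsilon> (fst (approx_step rng h \<epsilon> s)) < stack_weight \<epsilon> (fst s)"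
    if "?c s" for s
    using stack_weight_step[OF assms(3)] that by (cases s) auto
  have "\<exists>t. ?w = Some t"
    by (rule measure_while_option_Some[where P = "\<lambda>_. True"
          and f = "\<lambda>s. stack_weight \<epsilon> (fst s)"]) (use decr in auto)
  then obtain t where t: "?w = Some t"
    by blast
  have "\<not> ?c t"
    by (rule while_option_stop[OF t])
  then obtain \<B> where \<B>: "t = ([], \<B>)"
    by (cases t) auto
  have "approx_inv rng h yL yU \<epsilon> t"
    by (rule while_option_rule[where P = "approx_inv rng h yL yU \<epsilon>", OF _ t init]) (rule inv)
  moreover have "outer_approx rng h yL yU \<epsilon> = (\<Union>B\<in>\<B>. box_set B)"
    unfolding outer_approx_def t by (simp add: \<B>)
  ultimately show ?thesis
    using that \<B> by blast
qed

lemma axis_aligned_outer_approx: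
  assumes "consistent_range rng h yL yU" "cbox yL yU \<noteq> {}" "\<epsilon> > 0"
  shows "axis_aligned (outer_approx rng h yL yU \<epsilon>)"
proof -
  obtain \<B> where \<B>: "outer_approx rng h yL yU \<epsilon> = (\<Union>B\<in>\<B>. box_set B)"
    "approx_inv rng h yL yU \<epsilon> ([], \<B>)"
    using outer_approx_correct[OF assms] .
  have "\<exists>a b. box_set B = cbox a b" for B :: "'a box"
    by (cases B) auto
  then show ?thesis
    unfolding axis_aligned_def \<B>(1) using \<B>(2)
    by (intro exI[of _ "box_set ` \<B>"]) (auto simp: approx_inv_def)
qed

lemma feasible_subset_outer_approx:
  assumes "consistent_range rng h yL yU" "cbox yL yU \<noteq> {}" "\<epsilon> > 0"
  shows "feasible h yL yU \<subseteq> outer_approx rng h yL yU \<epsilon>"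
  by (rule outer_approx_correct[OF assms]) (auto simp: approx_inv_def)

lemma compact_axis_aligned: "axis_aligned A \<Longrightarrow> compact A"
  unfolding axis_aligned_def by (auto intro!: compact_Union)

section \<open>Convergence of the procedure\<close>

text \<open>
  For small tolerances every constraint is violated by at most \<open>\<delta>\<close> on the returned region.
\<close>

lemma outer_approx_violation:
  assumes cons: "consistent_range rng h yL yU" and ne: "cbox yL yU \<noteq> {}" and "\<delta> > 0"
  shows "\<exists>e>0. \<forall>\<epsilon>. 0 < \<epsilon> \<and> \<epsilon> < e \<longrightarrow>
    outer_approx rng h yL yU \<epsilon> \<subseteq> {y \<in> cbox yL yU. \<forall>j\<in>Basis. h y \<bullet> j \<le> \<delta>}"
proof -
  obtain e where e: "e > 0" "\<And>B. box_set B \<noteq> {} \<Longrightarrow> box_set B \<subseteq> cbox yL yU \<Longrightarrow>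
      diameter (box_set B) < e \<Longrightarrow> diameter (box_set (rng h B)) < \<delta>"
    using cons \<open>\<delta> > 0\<close> unfolding consistent_range_def by metis
  have "y \<in> cbox yL yU \<and> h y \<bullet> j \<le> \<delta>"
    if \<epsilon>: "0 < \<epsilon>" "\<epsilon> < e" and y: "y \<in> outer_approx rng h yL yU \<epsilon>" and j: "j \<in> Basis" for \<epsilon> y j
  proof -
    obtain \<B> where \<B>: "outer_approx rng h yL yU \<epsilon> = (\<Union>B\<in>\<B>. box_set B)"
      "approx_inv rng h yL yU \<epsilon> ([], \<B>)"
      using outer_approx_correct[OF cons ne \<epsilon>(1)] .
    obtain B where B: "B \<in> \<B>" "y \<in> box_set B"
      using y \<B> by blast
    then have sub: "box_set B \<subseteq> cbox yL yU"
      and kept: "(\<forall>j\<in>Basis. snd (rng h B) \<bullet> j \<le> 0)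
        \<or> diameter (box_set B) < \<epsilon> \<and> (\<forall>j\<in>Basis. fst (rng h B) \<bullet> j \<le> 0)"
      using \<B>(2) by (auto simp: approx_inv_def)
    have upper: "h y \<bullet> j \<le> snd (rng h B) \<bullet> j"
      by (rule range_bounds(2)[OF cons sub B(2) j])
    have "snd (rng h B) \<bullet> j \<le> \<delta>"
      using kept
    proof (elim disjE conjE)
      assume "\<forall>j\<in>Basis. snd (rng h B) \<bullet> j \<le> 0"
      then show ?thesis
        using j \<open>\<delta> > 0\<close> by force
    next
      assume small: "diameter (box_set B) < \<epsilon>" and lower: "\<forall>j\<in>Basis. fst (rng h B) \<bullet> j \<le> 0"
      obtain hL hU where r: "rng h B = (hL, hU)"
        by fastforce
      have "\<forall>i\<in>Basis. hL \<bullet> i \<le> hU \<bullet> i"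
        using range_bounds[OF cons sub B(2)] r by force
      then have "dist hL hU < \<delta>"
        using e(2)[of B] small \<epsilon>(2) B(2) sub by (auto simp: r diameter_cbox)
      moreover have "hU \<bullet> j - hL \<bullet> j \<le> dist hL hU"
        using Basis_le_norm[OF j, of "hU - hL"]
        by (simp add: dist_norm norm_minus_commute inner_diff_left)
      ultimately show ?thesis
        using lower j by (force simp: r)
    qed
    then show ?thesis
      using upper sub B(2) by auto
  qed
  then show ?thesis
    using e(1) nonempty_Basis by (intro exI[of _ e]) blast
qed

lemma nearly_feasible_near_feasible:
  fixes h :: "'a::euclidean_space \<Rightarrow> 'b::euclidean_space" and \<Phi> :: "'a \<Rightarrow> 'c::metric_space"
  assumes h: "continuous_on (cbox yL yU) h" and \<Phi>: "continuous_on (cbox yL yU) \<Phi>" and "\<eta> > 0"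
  shows "\<exists>\<delta>>0. \<forall>y\<in>cbox yL yU. (\<forall>j\<in>Basis. h y \<bullet> j \<le> \<delta>) \<longrightarrow>
    (\<exists>s\<in>feasible h yL yU. dist (\<Phi> y) (\<Phi> s) < \<eta>)"
proof (rule ccontr)
  assume "\<not> ?thesis"
  then have "\<exists>y\<in>cbox yL yU. (\<forall>j\<in>Basis. h y \<bullet> j \<le> inverse (real (Suc n))) \<and>
      \<not> (\<exists>s\<in>feasible h yL yU. dist (\<Phi> y) (\<Phi> s) < \<eta>)" for n
    by (metis inverse_positive_iff_positive of_nat_0_less_iff zero_less_Suc)
  then obtain y where y: "\<And>n. y n \<in> cbox yL yU"
    "\<And>n j. j \<in> Basis \<Longrightarrow> h (y n) \<bullet> j \<le> inverse (real (Suc n))"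
    "\<And>n s. s \<in> feasible h yL yU \<Longrightarrow> \<not> dist (\<Phi> (y n)) (\<Phi> s) < \<eta>"
    by metis
  obtain l r where l: "l \<in> cbox yL yU" "strict_mono r" "(y \<circ> r) \<longlonglongrightarrow> l"
    using compact_cbox[of yL yU] y(1) unfolding compact_def by metis
  have hl: "(\<lambda>n. h (y (r n))) \<longlonglongrightarrow> h l" and \<Phi>l: "(\<lambda>n. \<Phi> (y (r n))) \<longlonglongrightarrow> \<Phi> l"
    using continuous_on_tendsto_compose[OF h l(3,1)] continuous_on_tendsto_compose[OF \<Phi> l(3,1)] y(1)
    by (auto simp: o_def)
  have "h l \<bullet> j \<le> 0" if j: "j \<in> Basis" for j
  proof (rule LIMSEQ_le)
    show "(\<lambda>n. h (y (r n)) \<bullet> j) \<longlonglongrightarrow> h l \<bullet> j"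
      by (intro tendsto_intros hl)
    show "(\<lambda>n. inverse (real (Suc (r n)))) \<longlonglongrightarrow> 0"
      using LIMSEQ_subseq_LIMSEQ[OF LIMSEQ_inverse_real_of_nat l(2)] by (simp add: o_def)
  qed (use y(2) j in blast)
  then have "l \<in> feasible h yL yU"
    using l by (simp add: feasible_def)
  moreover have "\<exists>n. dist (\<Phi> (y (r n))) (\<Phi> l) < \<eta>"
    using \<Phi>l \<open>\<eta> > 0\<close> unfolding lim_sequentially by blast
  ultimately show False
    using y(3) by blast
qed

lemma outer_approx_near:
  fixes \<Phi> :: "'a::euclidean_space \<Rightarrow> 'c::metric_space"
  assumes "consistent_range rng h yL yU" "cbox yL yU \<noteq> {}"
    and "continuous_on (cbox yL yU) h" "continuous_on (cbox yL yU) \<Phi>" "\<eta> > 0"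
  shows "\<exists>e>0. \<forall>\<epsilon>. 0 < \<epsilon> \<and> \<epsilon> < e \<longrightarrow>
    (\<forall>y\<in>outer_approx rng h yL yU \<epsilon>. \<exists>s\<in>feasible h yL yU. dist (\<Phi> y) (\<Phi> s) < \<eta>)"
proof -
  obtain \<delta> where "\<delta> > 0" and \<delta>: "\<forall>y\<in>cbox yL yU. (\<forall>j\<in>Basis. h y \<bullet> j \<le> \<delta>) \<longrightarrow>
      (\<exists>s\<in>feasible h yL yU. dist (\<Phi> y) (\<Phi> s) < \<eta>)"
    using nearly_feasible_near_feasible[OF assms(3-5)] by blast
  show ?thesis
    using outer_approx_violation[OF assms(1,2) \<open>\<delta> > 0\<close>] \<delta> by (fast dest: subsetD)
qed

section \<open>Hausdorff distance of convex hulls\<close>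

lemma hausdorff_dist_hull_le:
  fixes P R :: "'a::real_normed_vector set"
  assumes "0 \<le> \<eta>" "R \<subseteq> convex hull P" "\<And>p. p \<in> P \<Longrightarrow> \<exists>r\<in>R. dist p r \<le> \<eta>"
  shows "hausdorff_dist (convex hull P) (convex hull R) \<le> ereal \<eta>"
proof -
  have nbhd: "{y + \<eta> *\<^sub>R u |y u. y \<in> X \<and> u \<in> cball 0 1}
      = (\<Union>y\<in>X. \<Union>w\<in>cball 0 \<eta>. {y + w})" for X :: "'a set"
  proof -
    have img: "(\<lambda>u. \<eta> *\<^sub>R u) ` cball 0 1 = cball (0 :: 'a) \<eta>"
      using assms(1) cball_scale[of \<eta> "0 :: 'a" 1]
      by (cases "\<eta> = 0") (auto simp: image_iff intro!: exI[of _ 0])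
    show ?thesis
      unfolding img[symmetric] by blast
  qed
  have "P \<subseteq> (\<Union>y\<in>convex hull R. \<Union>w\<in>cball 0 \<eta>. {y + w})"
  proof
    fix p assume "p \<in> P"
    then obtain r where r: "r \<in> R" "dist p r \<le> \<eta>"
      using assms(3) by blast
    then have "p - r \<in> cball 0 \<eta>" "p = r + (p - r)"
      by (auto simp: dist_norm norm_minus_commute)
    then show "p \<in> (\<Union>y\<in>convex hull R. \<Union>w\<in>cball 0 \<eta>. {y + w})"
      using hull_inc[OF r(1), of convex] by blast
  qed
  then have "convex hull P \<subseteq> {y + \<eta> *\<^sub>R u |y u. y \<in> convex hull R \<and> u \<in> cball 0 1}"
    unfolding nbhd by (intro hull_minimal convex_sums) auto
  moreover have "convex hull R \<subseteq> {y + \<eta> *\<^sub>R u |y u. y \<in> convex hull P \<and> u \<in> cball 0 1}"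
  proof -
    have "convex hull R \<subseteq> convex hull P"
      using assms(2) by (simp add: hull_minimal)
    then show ?thesis
      by (force intro: exI[of _ 0])
  qed
  ultimately show ?thesis
    unfolding hausdorff_dist_def using assms(1) by (intro Inf_lower) blast
qed

lemma hausdorff_dist_nonneg: "0 \<le> hausdorff_dist C D"
  unfolding hausdorff_dist_def by (intro Inf_greatest) auto

lemma continuous_on_lipschitz_components:
  fixes g :: "'a::metric_space \<Rightarrow> real ^ 'q"
  assumes "\<forall>j. \<exists>L. L-lipschitz_on UNIV (\<lambda>x. g x $ j)"
  shows "continuous_on X g"
proof -
  have "continuous_on X (\<lambda>x. g x $ j)" for j
    using assms lipschitz_on_continuous_on continuous_on_subset by blast
  then have "continuous_on X (\<lambda>x. \<chi> j. g x $ j)"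
    by (rule continuous_on_vec_lambda)
  then show ?thesis by simp
qed

theorem theorem8:
  fixes xL xU :: "real ^ 'n"
    and tL tU :: "real ^ 'k"
    and g :: "real ^ 'n \<Rightarrow> real ^ 'q"
    and f :: "real ^ 'n \<Rightarrow> real ^ 'k"
    and M :: "'m::finite \<Rightarrow> real ^ 'k \<Rightarrow> real"
    and rng :: "((real ^ 'n) \<times> (real ^ 'k) \<Rightarrow> (real ^ 'q) \<times> (real ^ 'k) \<times> (real ^ 'k))
        \<Rightarrow> ((real ^ 'n) \<times> (real ^ 'k)) box \<Rightarrow> ((real ^ 'q) \<times> (real ^ 'k) \<times> (real ^ 'k)) box"
    and D :: "(real ^ 'n) set"
    and G :: "((real ^ 'n) \<times> (real ^ 'm)) set"
    and H :: "nat \<Rightarrow> ((real ^ 'n) \<times> (real ^ 'k)) set"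
    and Q :: "nat \<Rightarrow> ((real ^ 'n) \<times> (real ^ 'm)) set"
  assumes x_bounds: "\<forall>i. xL $ i \<le> xU $ i"
    and g_lipschitz: "\<forall>j. \<exists>L. L-lipschitz_on UNIV (\<lambda>x. g x $ j)"
    and f_bounded: "\<forall>j. bounded (range (\<lambda>x. f x $ j))"
    and f_lipschitz: "\<forall>j. \<exists>L. L-lipschitz_on UNIV (\<lambda>x. f x $ j)"
    and M_multilinear: "\<forall>i. multilinear (M i)"
    and t_bounds: "\<forall>x\<in>cbox xL xU. \<forall>j. tL $ j \<le> f x $ j \<and> f x $ j \<le> tU $ j"
    and range_consistent: "consistent_range rng (graph_constraints g f) (xL, tL) (xU, tU)"
  defines "D \<equiv> {x. (\<forall>j. g x $ j \<le> 0) \<and> (\<forall>i. xL $ i \<le> x $ i \<and> x $ i \<le> xU $ i)}"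
    and "G \<equiv> {(x, \<mu>). x \<in> D \<and> (\<forall>i. \<mu> $ i = M i (f x))}"
    and "H \<equiv> (\<lambda>\<nu>. outer_approx rng (graph_constraints g f) (xL, tL) (xU, tU) (1 / real \<nu>))"
    and "Q \<equiv> (\<lambda>\<nu>. {(x, \<mu>). \<exists>t. (x, t) \<in> corner (H \<nu>) \<and> (\<forall>i. \<mu> $ i = M i t)})"
  shows "(\<forall>\<nu>\<ge>1. axis_aligned (H \<nu>) \<and> graph_on D f \<subseteq> H \<nu>)
    \<and> (\<forall>\<nu>\<ge>1. polyhedron (convex hull (Q \<nu>)) \<and> G \<subseteq> convex hull (Q \<nu>))
    \<and> ((\<lambda>\<nu>. hausdorff_dist (convex hull (Q \<nu>)) (convex hull G)) \<longlonglongrightarrow> 0)"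
proof -
  let ?h = "graph_constraints g f" and ?yL = "(xL, tL)" and ?yU = "(xU, tU)"
  define \<Phi> :: "(real ^ 'n) \<times> (real ^ 'k) \<Rightarrow> (real ^ 'n) \<times> (real ^ 'm)"
    where "\<Phi> y = (fst y, \<chi> i. M i (snd y))" for y
  define S where "S = feasible ?h ?yL ?yU"
  have "xL \<in> cbox xL xU"
    using x_bounds by (simp add: mem_box_cart)
  moreover have f_box: "f x \<in> cbox tL tU" if "x \<in> cbox xL xU" for x
    using t_bounds that by (simp add: mem_box_cart)
  ultimately have ne: "cbox ?yL ?yU \<noteq> {}"
    unfolding cbox_Pair_eq by blast
  have "(\<forall>j\<in>Basis. y \<bullet> j \<le> 0) \<longleftrightarrow> (\<forall>j. y $ j \<le> 0)" for y :: "real ^ 'q"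
    by (auto simp: Basis_vec_def inner_axis)
  then have D_eq: "D = feasible g xL xU"
    unfolding D_def feasible_def by (auto simp: mem_box_cart)
  have S_eq: "S = graph_on D f"
    unfolding S_def D_eq by (rule feasible_graph_constraints) (rule f_box)
  have mem_\<Phi>_image: "(x, \<mu>) \<in> \<Phi> ` X \<longleftrightarrow> (\<exists>t. (x, t) \<in> X \<and> (\<forall>i. \<mu> $ i = M i t))" for x \<mu> X
  proof -
    have "(x, \<mu>) \<in> \<Phi> ` X \<longleftrightarrow> (\<exists>t. (x, t) \<in> X \<and> \<mu> = (\<chi> i. M i t))"
      unfolding image_iff Bex_def split_paired_Ex \<Phi>_def by auto
    then show ?thesis
      by (simp add: vec_eq_iff)
  qed
  have G_eq: "G = \<Phi> ` S"
    unfolding set_eq_iff split_paired_All mem_\<Phi>_image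
    by (auto simp: G_def S_eq graph_on_def)
  have Q_eq: "Q \<nu> = \<Phi> ` corner (H \<nu>)" for \<nu>
    unfolding set_eq_iff split_paired_All mem_\<Phi>_image by (simp add: Q_def)

  have \<Phi>_affine: "coord_affine (\<lambda>y. u \<bullet> \<Phi> y)" for u
  proof -
    have "u \<bullet> \<Phi> y = fst u \<bullet> fst y + (\<Sum>i\<in>UNIV. snd u $ i * M i (snd y))" for y
      by (simp add: \<Phi>_def inner_prod_def inner_vec_def)
    moreover have "coord_affine (\<lambda>y :: (real ^ 'n) \<times> (real ^ 'k). fst u \<bullet> fst y)"
      by (intro coord_affine_linear linearI) (simp_all add: inner_right_distrib)
    moreover have "coord_affine (\<lambda>y :: (real ^ 'n) \<times> (real ^ 'k). \<Sum>i\<in>UNIV. snd u $ i * M i (snd y))"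
      by (intro coord_affine_sum coord_affine_cmult coord_affine_snd multilinear_coord_affine)
        (use M_multilinear in blast)
    ultimately show ?thesis
      by (simp only: coord_affine_add)
  qed
  have "continuous_on X (\<lambda>y :: (real ^ 'n) \<times> (real ^ 'k). M i (snd y))" for X i
    using M_multilinear
    by (intro continuous_on_coord_affine coord_affine_snd multilinear_coord_affine) blast
  then have \<Phi>_cont: "continuous_on X \<Phi>" for X
    unfolding \<Phi>_def
    by (intro continuous_on_Pair continuous_on_vec_lambda continuous_on_fst continuous_on_id)
  have h_cont: "continuous_on X ?h" for X
    unfolding graph_constraints_def case_prod_unfold
    by (intro continuous_intros
        continuous_on_compose2[OF continuous_on_lipschitz_components[OF g_lipschitz, of UNIV]]
        continuous_on_compose2[OF continuous_on_lipschitz_components[OF f_lipschitz, of UNIV]]) auto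

  have H_aligned: "axis_aligned (H \<nu>)" and S_H: "S \<subseteq> H \<nu>" if "\<nu> \<ge> 1" for \<nu>
    unfolding H_def S_def using that
    by (intro axis_aligned_outer_approx feasible_subset_outer_approx range_consistent ne; simp)+
  have polyhedron: "polyhedron (convex hull (Q \<nu>))" if "\<nu> \<ge> 1" for \<nu>
    unfolding Q_eq using finite_corner[OF H_aligned[OF that]]
    by (intro polytope_imp_polyhedron polytope_convex_hull) simp
  have G_hull: "G \<subseteq> convex hull (Q \<nu>)" if "\<nu> \<ge> 1" for \<nu>
    unfolding G_eq Q_eq
    using image_in_hull_corners[OF compact_axis_aligned finite_corner \<Phi>_affine] H_aligned S_H that
    by blast

  have dist_le: "\<forall>\<^sub>F \<nu> in sequentially. hausdorff_dist (convex hull (Q \<nu>)) (convex hull G) \<le> ereal \<eta>"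
    if "\<eta> > 0" for \<eta>
  proof -
    obtain e where "e > 0" and e: "\<And>\<epsilon> y. 0 < \<epsilon> \<Longrightarrow> \<epsilon> < e \<Longrightarrow> y \<in> outer_approx rng ?h ?yL ?yU \<epsilon>
        \<Longrightarrow> \<exists>s\<in>S. dist (\<Phi> y) (\<Phi> s) < \<eta>"
      using outer_approx_near[OF range_consistent ne h_cont \<Phi>_cont \<open>\<eta> > 0\<close>] unfolding S_def
      by blast
    have "\<forall>\<^sub>F \<nu> in sequentially. 1 / real \<nu> < e"
      using order_tendstoD(2)[OF lim_1_over_n \<open>e > 0\<close>] by simp
    then show ?thesis
      using eventually_ge_at_top[of 1]
    proof eventually_elim
      case (elim \<nu>)
      show ?case
      proof (rule hausdorff_dist_hull_le)
        show "G \<subseteq> convex hull (Q \<nu>)"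
          by (rule G_hull[OF elim(2)])
        fix p assume "p \<in> Q \<nu>"
        then obtain y where y: "y \<in> H \<nu>" "p = \<Phi> y"
          using corner_subset unfolding Q_eq by blast
        then show "\<exists>r\<in>G. dist p r \<le> \<eta>"
          using e[of "1 / real \<nu>" y] elim unfolding H_def G_eq by force
      qed (use that in simp)
    qed
  qed
  have "(\<lambda>\<nu>. hausdorff_dist (convex hull (Q \<nu>)) (convex hull G)) \<longlonglongrightarrow> 0"
  proof (rule order_tendstoI)
    fix a :: ereal
    assume "a < 0"
    then show "\<forall>\<^sub>F \<nu> in sequentially. a < hausdorff_dist (convex hull (Q \<nu>)) (convex hull G)"
      using hausdorff_dist_nonneg order.strict_trans2 by (intro always_eventually) blast
  next
    fix a :: ereal
    assume "0 < a"
    then obtain \<eta> where "0 < ereal \<eta>" "ereal \<eta> < a"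
      using ereal_dense2 by blast
    then show "\<forall>\<^sub>F \<nu> in sequentially. hausdorff_dist (convex hull (Q \<nu>)) (convex hull G) < a"
      using dist_le[of \<eta>] by (auto elim!: eventually_mono)
  qed
  then show ?thesis
    using H_aligned S_H S_eq polyhedron G_hull by blast
qed

end
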